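(* Let $X,Y$ be complete metric spaces and $E,F$ nontrivial Banach spaces, and assume that $Y$ is bounded. A map $T:U(X,E)\to\operatorname{Lip}(Y,F)$ is biseparating if and only if $X$ and $Y$ are finite sets of the same cardinality and there are a bijection $\psi:Y\to X$ and bijections $\Phi(y,\cdot):E\to F$ for each $y\in Y$ such that $Tf(y)=\Phi(y,f(\psi(y)))$ for all $f\in U(X,E)$ and all $y\in Y$.
   Context: $U(X,E)$ is the space of uniformly continuous functions $X\to E$; $\operatorname{Lip}(Y,F)$ is the space of Lipschitz functions $Y\to F$. For a function $f$ let $C(f)=\{x: f(x)\neq 0\}$, and write $f\perp_h g$ if $C(f-h)\cap C(g-h)=\emptyset$. A map $T$ (not assumed linear) between two function spaces is biseparating if it is a bijection and for all $f,g,h$ in its domain: $f\perp_h g\iff Tf\perp_{Th}Tg$. *)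

theory Defs
  imports "HOL-Analysis.Analysis"
begin

text \<open>
  A metric space is a subset \<open>X\<close> of a type of class \<^class>\<open>metric_space\<close>, so that the empty
  space is included. A function on \<open>X\<close> is represented by its extensional representative
  (constantly \<^const>\<open>undefined\<close> off \<open>X\<close>), so that equality of representatives is equality
  of functions on \<open>X\<close>; otherwise bijectivity of maps between function spaces would depend on
  irrelevant values.
\<close>

definition UC_space :: "'a::metric_space set \<Rightarrow> ('a \<Rightarrow> 'e::metric_space) set" where
  "UC_space X = {f \<in> extensional X. uniformly_continuous_on X f}"

definition Lip_space :: "'a::metric_space set \<Rightarrow> ('a \<Rightarrow> 'e::metric_space) set" where
  "Lip_space Y = {f \<in> extensional Y. \<exists>L. L-lipschitz_on Y f}"

definition cozero :: "'a set \<Rightarrow> ('a \<Rightarrow> 'e::zero) \<Rightarrow> 'a set" where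
  "cozero X f = {x \<in> X. f x \<noteq> 0}"

definition perp_at :: "'a set \<Rightarrow> ('a \<Rightarrow> 'e::group_add) \<Rightarrow> ('a \<Rightarrow> 'e) \<Rightarrow> ('a \<Rightarrow> 'e) \<Rightarrow> bool" where
  "perp_at X h f g \<longleftrightarrow> cozero X (\<lambda>x. f x - h x) \<inter> cozero X (\<lambda>x. g x - h x) = {}"

text \<open>\<open>A\<close> and \<open>B\<close> are the function spaces on \<open>X\<close> and \<open>Y\<close> between which \<open>T\<close> acts.\<close>

definition biseparating ::
  "'a set \<Rightarrow> ('a \<Rightarrow> 'e::group_add) set \<Rightarrow> 'b set \<Rightarrow> ('b \<Rightarrow> 'f::group_add) set
    \<Rightarrow> (('a \<Rightarrow> 'e) \<Rightarrow> ('b \<Rightarrow> 'f)) \<Rightarrow> bool" where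
  "biseparating X A Y B T \<longleftrightarrow>
     bij_betw T A B \<and>
     (\<forall>f\<in>A. \<forall>g\<in>A. \<forall>h\<in>A. perp_at X h f g \<longleftrightarrow> perp_at Y (T h) (T f) (T g))"

end

theory Submission
  imports Defs
begin

text \<open>
  A biseparating map \<open>T\<close> respects the relation "at every point \<open>h\<close> agrees with \<open>f\<close> or with \<open>g\<close>". With
  \<open>T 0 = 0\<close>, which a translation achieves, this has two consequences that carry the whole proof:
  \<open>T\<close> and its inverse preserve disjointness of supports, and if \<open>f\<close> is a restriction of \<open>g\<close> to some set
  (that is, \<open>f\<close> takes only the values \<open>0\<close> and those of \<open>g\<close>), then \<open>T f\<close> is a restriction of \<open>T g\<close>, and
  conversely. In particular \<open>T\<close> of a sum of disjoint functions is known wherever \<open>T\<close> of a summand does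
  not vanish.

  The substance is that \<open>X\<close> must be finite. Suppose it is infinite, choose disjoint nonzero \<open>u\<^sub>n\<close>
  on \<open>X\<close>, and let \<open>V\<^sub>n\<close> be the support of \<open>T u\<^sub>n\<close>. The distance to the complement of \<open>V\<^sub>n\<close>, multiplied by a
  slope \<open>c\<close>, is a hill supported in \<open>V\<^sub>n\<close>; let \<open>f\<^sub>n\<^sub>,\<^sub>c\<close> be its preimage under \<open>T\<close>. The contradiction is between
  two facts.

  On the \<open>X\<close> side, for every sequence of slopes \<open>c\<^sub>k\<close> and every sufficiently sparse
  choice of indices \<open>n\<^sub>k\<close>, the disjoint sum of the \<open>f\<close> with indices \<open>n\<^sub>k\<close>, \<open>c\<^sub>k\<close> is uniformly continuous. If \<open>X\<close> is
  uniformly discrete, every function is. Otherwise the \<open>u\<^sub>n\<close> can be supported in small balls around \<open>a\<^sub>n\<close>, with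
  points \<open>b\<^sub>n\<close> off the supports and \<open>dist a\<^sub>n b\<^sub>n\<close> tending to \<open>0\<close>. For fixed \<open>c\<close> all hills of slope \<open>c\<close> together form
  a single Lipschitz function; its preimage \<open>F\<close> is uniformly continuous, vanishes at all \<open>b\<^sub>n\<close>, and has
  every \<open>f\<^sub>n\<^sub>,\<^sub>c\<close> as a restriction. So \<open>f\<^sub>n\<^sub>,\<^sub>c\<close> tends uniformly to \<open>0\<close> as \<open>n\<close> grows, and the sum converges uniformly
  (lemma \<open>no_clustering_domain\<close>).

  On the \<open>Y\<close> side, \<open>T\<close> of such a sum consists of hills whose slopes grow without bound, and for suitable
  slopes it is not in \<open>Lip_space Y\<close>: if the heights of the \<open>V\<^sub>n\<close> do not tend to \<open>0\<close> it is unbounded although \<open>Y\<close>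
  is bounded, and otherwise it is not Lipschitz (lemma \<open>not_gluable\<close>).

  Once \<open>X\<close> is finite, changing a function at a single point of \<open>X\<close> changes its image at a single point of
  \<open>Y\<close>; the resulting correspondence of points is a bijection that does not depend on the function
  that is changed (lemma \<open>finite_domain_representation\<close>).
\<close>

section \<open>The two function spaces\<close>

lemma Lip_space_subset_UC_space: "Lip_space X \<subseteq> UC_space X"
  by (auto simp: Lip_space_def UC_space_def lipschitz_on_uniformly_continuous)

lemma UC_space_finite:
  assumes "finite X"
  shows "UC_space X = extensional X"
proof -
  have "uniformly_continuous_on X f" for f :: "'a \<Rightarrow> 'b"
    using assms compact_uniformly_continuous continuous_on_finite finite_imp_compact by blast
  then show ?thesis by (auto simp: UC_space_def)
qed

lemma uniformly_continuous_on_uniformly_discrete: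
  fixes f :: "'a::metric_space \<Rightarrow> 'b::metric_space"
  assumes "0 < \<epsilon>" and "\<And>x y. x \<in> X \<Longrightarrow> y \<in> X \<Longrightarrow> x \<noteq> y \<Longrightarrow> \<epsilon> \<le> dist x y"
  shows "uniformly_continuous_on X f"
  unfolding uniformly_continuous_on_def
proof (intro allI impI exI[of _ \<epsilon>] conjI ballI)
  fix e x x' assume "(0::real) < e" "x \<in> X" "x' \<in> X" "dist x' x < \<epsilon>"
  moreover from this have "x' = x" using assms(2)[of x' x] by linarith
  ultimately show "dist (f x') (f x) < e" by simp
qed (rule assms(1))

lemma UC_space_uniformly_discrete:
  assumes "0 < \<epsilon>" and "\<And>x y. x \<in> X \<Longrightarrow> y \<in> X \<Longrightarrow> x \<noteq> y \<Longrightarrow> \<epsilon> \<le> dist x y"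
  shows "UC_space X = extensional X"
  using uniformly_continuous_on_uniformly_discrete[of \<epsilon> X] assms by (auto simp: UC_space_def)

lemma restrict_in_Lip_space:
  assumes "L-lipschitz_on X f"
  shows "restrict f X \<in> Lip_space X"
proof -
  have "L-lipschitz_on X (restrict f X)"
    by (rule lipschitz_on_transform[OF assms]) simp
  then show ?thesis by (auto simp: Lip_space_def)
qed

lemma Lip_space_finite:
  assumes "finite Y"
  shows "Lip_space Y = extensional Y"
proof -
  have "\<exists>L. L-lipschitz_on Y f" for f :: "'a \<Rightarrow> 'b"
  proof -
    define L where "L = (\<Sum>p\<in>Y\<times>Y. dist (f (fst p)) (f (snd p)) / dist (fst p) (snd p))"
    have "dist (f x) (f y) \<le> L * dist x y" if "x \<in> Y" "y \<in> Y" for x y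
    proof (cases "x = y")
      case False
      have "dist (f (fst (x,y))) (f (snd (x,y))) / dist (fst (x,y)) (snd (x,y)) \<le> L"
        unfolding L_def by (rule member_le_sum) (use that assms in auto)
      then show ?thesis using False by (simp add: field_simps)
    qed simp
    moreover have "0 \<le> L" unfolding L_def by (intro sum_nonneg) auto
    ultimately show ?thesis by (blast intro: lipschitz_onI)
  qed
  then show ?thesis by (auto simp: Lip_space_def)
qed

lemma Lip_space_bounded:
  assumes "g \<in> Lip_space Y" and "bounded Y"
  shows "bounded (g ` Y)"
proof (cases "Y = {}")
  case False
  then obtain a where a: "a \<in> Y" by auto
  obtain L where L: "L-lipschitz_on Y g" using assms by (auto simp: Lip_space_def)
  obtain D where D: "\<And>y. y \<in> Y \<Longrightarrow> dist a y \<le> D"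
    using assms(2) a bounded_any_center by blast
  have "dist (g a) (g y) \<le> L * D" if "y \<in> Y" for y
    using lipschitz_onD[OF L a that] mult_left_mono[OF D[OF that] lipschitz_on_nonneg[OF L]]
    by linarith
  then show ?thesis unfolding bounded_def by blast
qed simp

lemma Lip_space_add:
  fixes f g :: "'a::metric_space \<Rightarrow> 'e::real_normed_vector"
  assumes "f \<in> Lip_space X" and "g \<in> Lip_space X"
  shows "(\<lambda>x\<in>X. f x + g x) \<in> Lip_space X"
proof -
  obtain L M where "L-lipschitz_on X f" "M-lipschitz_on X g"
    using assms by (auto simp: Lip_space_def)
  from lipschitz_on_add[OF this] show ?thesis by (rule restrict_in_Lip_space)
qed

lemma Lip_space_diff:
  fixes f g :: "'a::metric_space \<Rightarrow> 'e::real_normed_vector"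
  assumes "f \<in> Lip_space X" and "g \<in> Lip_space X"
  shows "(\<lambda>x\<in>X. f x - g x) \<in> Lip_space X"
proof -
  obtain L M where "L-lipschitz_on X f" "M-lipschitz_on X g"
    using assms by (auto simp: Lip_space_def)
  from lipschitz_on_diff[OF this] show ?thesis by (rule restrict_in_Lip_space)
qed

lemma Lip_space_scaleR:
  fixes v :: "'e::real_normed_vector"
  assumes "0 \<le> L" and "\<And>x y. x \<in> X \<Longrightarrow> y \<in> X \<Longrightarrow> \<bar>\<phi> x - \<phi> y\<bar> \<le> L * dist x y"
  shows "(\<lambda>x\<in>X. \<phi> x *\<^sub>R v) \<in> Lip_space X"
proof (rule restrict_in_Lip_space, rule lipschitz_onI)
  fix x y assume "x \<in> X" "y \<in> X"
  have "dist (\<phi> x *\<^sub>R v) (\<phi> y *\<^sub>R v) = \<bar>\<phi> x - \<phi> y\<bar> * norm v"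
    by (simp add: dist_norm scaleR_diff_left[symmetric])
  also have "\<dots> \<le> (L * dist x y) * norm v"
    using assms(2)[OF \<open>x \<in> X\<close> \<open>y \<in> X\<close>] by (intro mult_right_mono) auto
  finally show "dist (\<phi> x *\<^sub>R v) (\<phi> y *\<^sub>R v) \<le> (L * norm v) * dist x y"
    by (simp add: algebra_simps)
qed (use assms in simp)

lemma perp_at_iff: "perp_at X h f g \<longleftrightarrow> (\<forall>x\<in>X. f x = h x \<or> g x = h x)"
  by (auto simp: perp_at_def cozero_def)

lemma zero_in_Lip_space: "(\<lambda>x\<in>X. 0) \<in> Lip_space X"
  by (rule restrict_in_Lip_space[OF lipschitz_on_constant])

lemma zero_in_UC_space: "(\<lambda>x\<in>X. 0) \<in> UC_space X"
  using zero_in_Lip_space Lip_space_subset_UC_space by blast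

lemma ex_Lip_space_bump:
  fixes v :: "'e::real_normed_vector"
  assumes "a \<in> X" and "0 < r" and "v \<noteq> 0"
  shows "\<exists>k\<in>Lip_space X. k a \<noteq> (0::'e) \<and> (\<forall>x\<in>X. r \<le> dist x a \<longrightarrow> k x = 0)"
proof -
  define \<phi> where "\<phi> x = max 0 (r - dist x a)" for x
  have "\<bar>\<phi> x - \<phi> y\<bar> \<le> 1 * dist x y" for x y
    using dist_triangle[of x a y] dist_triangle[of y a x] by (simp add: \<phi>_def dist_commute)
  then have "(\<lambda>x\<in>X. \<phi> x *\<^sub>R v) \<in> Lip_space X"
    by (intro Lip_space_scaleR[of 1]) auto
  moreover have "\<phi> a \<noteq> 0" "\<And>x. r \<le> dist x a \<Longrightarrow> \<phi> x = 0"
    using assms by (auto simp: \<phi>_def)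
  ultimately show ?thesis using assms by (intro bexI[of _ "\<lambda>x\<in>X. \<phi> x *\<^sub>R v"]) auto
qed

lemma ex_Lip_space_perturbation:
  fixes g :: "'a::metric_space \<Rightarrow> 'e::real_normed_vector"
  assumes "g \<in> Lip_space X" and "a \<in> X" and "0 < r" and "(v::'e) \<noteq> 0"
  shows "\<exists>k\<in>Lip_space X. k a \<noteq> g a \<and> (\<forall>x\<in>X. r \<le> dist x a \<longrightarrow> k x = g x)"
proof -
  obtain b :: "'a \<Rightarrow> 'e" where "b \<in> Lip_space X" "b a \<noteq> 0" "\<forall>x\<in>X. r \<le> dist x a \<longrightarrow> b x = 0"
    using ex_Lip_space_bump[OF assms(2,3,4)] by blast
  then show ?thesis
    using assms by (intro bexI[of _ "\<lambda>x\<in>X. g x + b x"]) (auto intro: Lip_space_add)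
qed

section \<open>Sums of functions with disjoint supports\<close>

text \<open>The pointwise sum of a sequence of functions of which at most one is nonzero at each point:
  picking a nonzero term avoids every question of convergence.\<close>

definition glue :: "(nat \<Rightarrow> 'a \<Rightarrow> 'e::zero) \<Rightarrow> 'a \<Rightarrow> 'e" where
  "glue h x = (if \<exists>k. h k x \<noteq> 0 then h (SOME k. h k x \<noteq> 0) x else 0)"

lemma glue_eq:
  assumes "\<And>m n. m \<noteq> n \<Longrightarrow> h m x = 0 \<or> h n x = 0" and "h k x \<noteq> 0"
  shows "glue h x = h k x"
proof -
  have "(SOME k. h k x \<noteq> 0) = k"
    using assms by (metis (mono_tags, lifting) someI)
  then show ?thesis using assms(2) by (auto simp: glue_def)
qed

lemma glue_zero: "(\<And>k. h k x = 0) \<Longrightarrow> glue h x = 0"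
  by (simp add: glue_def)

text \<open>If the terms tend to \<open>0\<close> uniformly, then disjointness makes the partial sums converge
  uniformly, without any summability of the norms.\<close>

lemma glue_in_UC_space:
  fixes h :: "nat \<Rightarrow> 'a::metric_space \<Rightarrow> 'e::real_normed_vector"
  assumes UC: "\<And>k. h k \<in> UC_space X"
    and disj: "\<And>m n x. x \<in> X \<Longrightarrow> m \<noteq> n \<Longrightarrow> h m x = 0 \<or> h n x = 0"
    and small: "\<And>\<epsilon>. 0 < \<epsilon> \<Longrightarrow> \<forall>\<^sub>F k in sequentially. \<forall>x\<in>X. norm (h k x) \<le> \<epsilon>"
  shows "(\<lambda>x\<in>X. glue h x) \<in> UC_space X"
proof -
  have "uniformly_continuous_on X (\<lambda>x\<in>X. glue h x)"
    unfolding uniformly_continuous_on_def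
  proof (intro allI impI)
    fix \<epsilon> :: real assume "0 < \<epsilon>"
    then obtain K where K: "\<And>k x. K \<le> k \<Longrightarrow> x \<in> X \<Longrightarrow> norm (h k x) \<le> \<epsilon> / 4"
      using small[of "\<epsilon> / 4"] by (auto simp: eventually_sequentially)
    define p where "p x = (\<Sum>k<K. h k x)" for x
    have near: "norm (glue h x - p x) \<le> \<epsilon> / 4" if "x \<in> X" for x
    proof (cases "\<exists>k. h k x \<noteq> 0")
      case True
      then obtain k where k: "h k x \<noteq> 0" by blast
      have "glue h x = h k x" using glue_eq[of h x k] disj[OF that] k by blast
      moreover have "p x = (\<Sum>j<K. if j = k then h k x else 0)"
        unfolding p_def by (rule sum.cong) (use disj[OF that] k in auto)
      then have "p x = (if k < K then h k x else 0)" by simp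
      ultimately show ?thesis using K[of k x] that \<open>0 < \<epsilon>\<close> by auto
    next
      case False
      then show ?thesis using \<open>0 < \<epsilon>\<close> by (simp add: p_def glue_zero)
    qed
    have "uniformly_continuous_on X p"
      unfolding p_def using UC by (intro uniformly_continuous_on_sum) (auto simp: UC_space_def)
    then obtain d where d: "0 < d"
      "\<And>x x'. x \<in> X \<Longrightarrow> x' \<in> X \<Longrightarrow> dist x' x < d \<Longrightarrow> dist (p x') (p x) < \<epsilon> / 4"
      unfolding uniformly_continuous_on_def using \<open>0 < \<epsilon>\<close> by (metis zero_less_divide_iff zero_less_numeral)
    have "dist (glue h x') (glue h x) < \<epsilon>" if "x \<in> X" "x' \<in> X" "dist x' x < d" for x x'
    proof -
      have "glue h x' - glue h x = (glue h x' - p x') + (p x' - p x) - (glue h x - p x)" by simp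
      then have "norm (glue h x' - glue h x) = norm ((glue h x' - p x') + (p x' - p x) - (glue h x - p x))"
        by (rule arg_cong)
      also have "\<dots> \<le> norm (glue h x' - p x') + norm (p x' - p x) + norm (glue h x - p x)"
        using norm_triangle_ineq[of "glue h x' - p x'" "p x' - p x"]
          norm_triangle_ineq4[of "(glue h x' - p x') + (p x' - p x)" "glue h x - p x"] by linarith
      finally show ?thesis
        using near[OF that(1)] near[OF that(2)] d(2)[OF that] \<open>0 < \<epsilon>\<close> by (simp add: dist_norm)
    qed
    then show "\<exists>d>0. \<forall>x\<in>X. \<forall>x'\<in>X. dist x' x < d
        \<longrightarrow> dist ((\<lambda>x\<in>X. glue h x) x') ((\<lambda>x\<in>X. glue h x) x) < \<epsilon>"
      using \<open>0 < d\<close> by auto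
  qed
  then show ?thesis by (simp add: UC_space_def)
qed

section \<open>Finite domains\<close>

text \<open>Over a finite \<open>X\<close>, changing a function \<open>h\<close> in the single coordinate \<open>x\<close> cannot change \<open>T h\<close> in
  two places \<open>y\<close>, \<open>y'\<close>: two perturbations of \<open>T h\<close> with disjoint supports around \<open>y\<close> and \<open>y'\<close> would come
  from two perturbations of \<open>h\<close> that both move the coordinate \<open>x\<close>, hence overlap.\<close>

lemma single_coordinate_of_base:
  fixes T :: "('a::metric_space \<Rightarrow> 'e::real_normed_vector) \<Rightarrow> ('b::metric_space \<Rightarrow> 'f::real_normed_vector)"
  assumes T: "biseparating X (UC_space X) Y (Lip_space Y) T" and X: "finite X"
    and e: "(e::'e) \<noteq> 0" and v: "(v::'f) \<noteq> 0"
    and h: "h \<in> UC_space X" and x: "x \<in> X"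
  shows "\<exists>y\<in>Y. \<forall>f\<in>UC_space X. f x \<noteq> h x \<longleftrightarrow> T f y \<noteq> T h y"
proof -
  have bij: "bij_betw T (UC_space X) (Lip_space Y)"
    using T by (simp add: biseparating_def)
  have perp: "\<And>f g h. f \<in> UC_space X \<Longrightarrow> g \<in> UC_space X \<Longrightarrow> h \<in> UC_space X \<Longrightarrow>
      (\<forall>x\<in>X. f x = h x \<or> g x = h x) \<longleftrightarrow> (\<forall>y\<in>Y. T f y = T h y \<or> T g y = T h y)"
    using T unfolding biseparating_def perp_at_iff by blast
  have mem: "T f \<in> Lip_space Y" if "f \<in> UC_space X" for f
    using bij that by (rule bij_betw_apply)
  define k where "k = h(x := h x + e)"
  have k: "k \<in> UC_space X"
    using h x by (auto simp: UC_space_finite[OF X] k_def extensional_def)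
  have "T k \<noteq> T h"
  proof
    assume "T k = T h"
    then have "k = h" using bij k h by (metis bij_betw_imp_inj_on inj_onD)
    then show False using e by (metis add_cancel_right_right fun_upd_same k_def)
  qed
  then obtain y where y: "y \<in> Y" "T k y \<noteq> T h y"
    using mem[OF k] mem[OF h] by (auto simp: Lip_space_def intro: extensionalityI)
  have moved: "\<exists>f\<in>UC_space X. T f = g \<and> f x \<noteq> h x"
    if g: "g \<in> Lip_space Y" and z: "z \<in> Y" "T k z \<noteq> T h z" "g z \<noteq> T h z" for g z
  proof -
    obtain f where f: "f \<in> UC_space X" "T f = g"
      using g bij by (metis (no_types, lifting) bij_betw_iff_bijections)
    then have "\<not> (\<forall>w\<in>X. f w = h w \<or> k w = h w)"
      using perp[OF f(1) k h] z by auto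
    then have "f x \<noteq> h x" by (auto simp: k_def split: if_splits)
    then show ?thesis using f by auto
  qed
  have only: "z = y" if z: "z \<in> Y" "T k z \<noteq> T h z" for z
  proof (rule ccontr)
    assume "z \<noteq> y"
    define r where "r = dist z y / 2"
    have "0 < r" using \<open>z \<noteq> y\<close> by (simp add: r_def)
    obtain g1 where g1: "g1 \<in> Lip_space Y" "g1 y \<noteq> T h y" "\<forall>w\<in>Y. r \<le> dist w y \<longrightarrow> g1 w = T h w"
      using ex_Lip_space_perturbation[OF mem[OF h] y(1) \<open>0 < r\<close> v] by blast
    obtain g2 where g2: "g2 \<in> Lip_space Y" "g2 z \<noteq> T h z" "\<forall>w\<in>Y. r \<le> dist w z \<longrightarrow> g2 w = T h w"
      using ex_Lip_space_perturbation[OF mem[OF h] z(1) \<open>0 < r\<close> v] by blast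
    obtain f1 where f1: "f1 \<in> UC_space X" "T f1 = g1" "f1 x \<noteq> h x" using moved g1 y by blast
    obtain f2 where f2: "f2 \<in> UC_space X" "T f2 = g2" "f2 x \<noteq> h x" using moved g2 z by blast
    have "r \<le> dist w y \<or> r \<le> dist w z" for w
      using dist_triangle[of z y w] by (auto simp: r_def dist_commute)
    then have "\<forall>w\<in>Y. T f1 w = T h w \<or> T f2 w = T h w" using g1 g2 f1 f2 by auto
    then show False using perp[OF f1(1) f2(1) h] f1 f2 x by auto
  qed
  have "f x \<noteq> h x \<longleftrightarrow> T f y \<noteq> T h y" if "f \<in> UC_space X" for f
  proof -
    have "f x \<noteq> h x \<longleftrightarrow> \<not> (\<forall>w\<in>X. f w = h w \<or> k w = h w)"
      using x e by (auto simp: k_def)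
    also have "\<dots> \<longleftrightarrow> \<not> (\<forall>w\<in>Y. T f w = T h w \<or> T k w = T h w)"
      using perp[OF that k h] by simp
    also have "\<dots> \<longleftrightarrow> T f y \<noteq> T h y" using only y by blast
    finally show ?thesis .
  qed
  then show ?thesis using y by blast
qed

text \<open>By the previous lemma each base \<open>h\<close> has its own map \<open>\<sigma> h\<close> from the coordinates of \<open>X\<close> to points of \<open>Y\<close>.
  Once these maps are known to be bijective and equal, the value \<open>T f y\<close> depends only on
  the value of \<open>f\<close> at the corresponding coordinate, so that constant functions reveal \<open>\<Phi>\<close>.\<close>

lemma finite_domain_representation:
  fixes T :: "('a::metric_space \<Rightarrow> 'e::real_normed_vector) \<Rightarrow> ('b::metric_space \<Rightarrow> 'f::real_normed_vector)"
  assumes T: "biseparating X (UC_space X) Y (Lip_space Y) T" and X: "finite X"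
    and e: "(e::'e) \<noteq> 0" and v: "(v::'f) \<noteq> 0"
  shows "\<exists>\<psi> \<Phi>. bij_betw \<psi> Y X \<and> (\<forall>y\<in>Y. bij (\<Phi> y)) \<and>
    (\<forall>f\<in>UC_space X. \<forall>y\<in>Y. T f y = \<Phi> y (f (\<psi> y)))"
proof -
  have bij: "bij_betw T (UC_space X) (Lip_space Y)"
    using T by (simp add: biseparating_def)
  have mem: "T f \<in> Lip_space Y" if "f \<in> UC_space X" for f
    using bij that by (rule bij_betw_apply)
  have onto: "\<exists>f\<in>UC_space X. T f = g" if "g \<in> Lip_space Y" for g
    using that bij by (metis (no_types, lifting) bij_betw_iff_bijections)
  have A: "UC_space X = (extensional X :: ('a \<Rightarrow> 'e) set)" by (rule UC_space_finite[OF X])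
  define \<sigma> where
    "\<sigma> h x = (SOME y. y \<in> Y \<and> (\<forall>f\<in>UC_space X. f x \<noteq> h x \<longleftrightarrow> T f y \<noteq> T h y))" for h x
  have \<sigma>_spec: "\<sigma> h x \<in> Y \<and> (\<forall>f\<in>UC_space X. f x \<noteq> h x \<longleftrightarrow> T f (\<sigma> h x) \<noteq> T h (\<sigma> h x))"
    if "h \<in> UC_space X" "x \<in> X" for h x
    unfolding \<sigma>_def by (rule someI_ex) (use single_coordinate_of_base[OF T X e v that] in blast)
  have \<sigma>1: "\<sigma> h x \<in> Y" if "h \<in> UC_space X" "x \<in> X" for h x
    using \<sigma>_spec[OF that] by simp
  have \<sigma>2: "f x \<noteq> h x \<longleftrightarrow> T f (\<sigma> h x) \<noteq> T h (\<sigma> h x)"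
    if "h \<in> UC_space X" "x \<in> X" "f \<in> UC_space X" for h x f
    using \<sigma>_spec[OF that(1,2)] that(3) by simp
  have onto_Y: "\<exists>x\<in>X. \<sigma> h x = y" if h: "h \<in> UC_space X" and y: "y \<in> Y" for h y
  proof (rule ccontr)
    assume "\<not> ?thesis"
    then have "y \<notin> \<sigma> h ` X" by auto
    moreover obtain r where "0 < r" "\<forall>z\<in>\<sigma> h ` X. z \<noteq> y \<longrightarrow> r \<le> dist y z"
      using finite_set_avoid[OF finite_imageI[OF X]] by blast
    ultimately have r: "0 < r" "\<And>x. x \<in> X \<Longrightarrow> r \<le> dist (\<sigma> h x) y"
      by (auto simp: dist_commute)
    obtain g where g: "g \<in> Lip_space Y" "g y \<noteq> T h y" "\<forall>w\<in>Y. r \<le> dist w y \<longrightarrow> g w = T h w"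
      using ex_Lip_space_perturbation[OF mem[OF h] y r(1) v] by blast
    obtain f where f: "f \<in> UC_space X" "T f = g" using onto g by blast
    have "f x = h x" if "x \<in> X" for x
      using \<sigma>2[OF h that f(1)] \<sigma>1[OF h that] g(3) r(2)[OF that] f(2) by auto
    then have "f = h" using f h by (auto simp: A intro: extensionalityI)
    then show False using f g by auto
  qed
  \<comment> \<open>If the coordinate \<open>x'\<close> for \<open>h'\<close> and a different coordinate \<open>x\<close> for \<open>h\<close> both governed \<open>y\<close>,
    fixing the value at \<open>x'\<close> would freeze the value of the image at \<open>y\<close>,
    while the value at \<open>x\<close> still decides whether that value is \<open>T h y\<close>.\<close>
  have same: "\<sigma> h x = \<sigma> h' x" if h: "h \<in> UC_space X" "h' \<in> UC_space X" and x: "x \<in> X" for h h' x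
  proof -
    obtain x' where x': "x' \<in> X" "\<sigma> h' x' = \<sigma> h x" using \<sigma>1[OF h(1) x] onto_Y[OF h(2)] by metis
    have "x' = x"
    proof (rule ccontr)
      assume ne: "x' \<noteq> x"
      define p where "p = h(x' := h' x', x := h x + e)"
      define q where "q = h(x' := h' x')"
      have "p \<in> UC_space X" "q \<in> UC_space X"
        using h x x' by (auto simp: A p_def q_def extensional_def)
      moreover have "p x' = h' x'" "q x' = h' x'" "p x \<noteq> h x" "q x = h x"
        using ne e by (auto simp: p_def q_def)
      ultimately show False
        using \<sigma>2[OF h(1) x, of p] \<sigma>2[OF h(1) x, of q] \<sigma>2[OF h(2) x'(1), of p]
          \<sigma>2[OF h(2) x'(1), of q] x'(2) by simp
    qed
    then show ?thesis using x' by simp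
  qed
  define s where "s = \<sigma> (\<lambda>x\<in>X. 0)"
  have sY: "s x \<in> Y" if "x \<in> X" for x
    unfolding s_def using \<sigma>1[OF zero_in_UC_space that] .
  have s: "f x \<noteq> h x \<longleftrightarrow> T f (s x) \<noteq> T h (s x)"
    if "f \<in> UC_space X" "h \<in> UC_space X" "x \<in> X" for f h x
    using \<sigma>2[OF that(2,3,1)] same[OF that(2) zero_in_UC_space that(3)] by (simp add: s_def)
  have const: "(\<lambda>x\<in>X. c) \<in> UC_space X" for c :: 'e by (simp add: A)
  have inj: "inj_on s X"
  proof (rule inj_onI, rule ccontr)
    fix x x' assume x: "x \<in> X" "x' \<in> X" "s x = s x'" "x \<noteq> x'"
    define k where "k = (\<lambda>x\<in>X. 0)(x := e)"
    have "k \<in> UC_space X" using x by (auto simp: A k_def extensional_def)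
    moreover have "k x \<noteq> (\<lambda>x\<in>X. 0) x" "k x' = (\<lambda>x\<in>X. 0) x'" using x e by (auto simp: k_def)
    ultimately show False using s[OF _ zero_in_UC_space] x by metis
  qed
  have "s ` X = Y" using onto_Y[OF zero_in_UC_space] sY by (auto simp: s_def)
  with inj have sb: "bij_betw s X Y" by (simp add: bij_betw_def)
  define \<psi> where "\<psi> = inv_into X s"
  define \<Phi> where "\<Phi> y c = T (\<lambda>x\<in>X. c) y" for y c
  have \<psi>b: "bij_betw \<psi> Y X" unfolding \<psi>_def by (rule bij_betw_inv_into[OF sb])
  have \<psi>: "\<psi> y \<in> X" "s (\<psi> y) = y" if "y \<in> Y" for y
    using sb that bij_betw_inv_into_right[OF sb that] bij_betw_apply[OF \<psi>b that] by (auto simp: \<psi>_def)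
  have rep: "T f y = \<Phi> y (f (\<psi> y))" if "f \<in> UC_space X" "y \<in> Y" for f y
    using s[OF that(1) const[of "f (\<psi> y)"] \<psi>(1)[OF that(2)]] \<psi>[OF that(2)] by (simp add: \<Phi>_def)
  have "bij (\<Phi> y)" if y: "y \<in> Y" for y
  proof (rule bijI)
    show "inj (\<Phi> y)"
    proof (rule injI)
      fix c d assume "\<Phi> y c = \<Phi> y d"
      then show "c = d" using s[OF const[of c] const[of d] \<psi>(1)[OF y]] \<psi>[OF y] by (simp add: \<Phi>_def)
    qed
    have "w \<in> range (\<Phi> y)" for w
    proof -
      obtain f where "f \<in> UC_space X" "T f = (\<lambda>y\<in>Y. w)"
        using onto restrict_in_Lip_space[OF lipschitz_on_constant] by metis
      then show ?thesis using rep[of f y] y by auto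
    qed
    then show "surj (\<Phi> y)" by auto
  qed
  with \<psi>b rep show ?thesis by blast
qed

lemma finite_representation_imp_biseparating:
  fixes T :: "('a::metric_space \<Rightarrow> 'e::real_normed_vector) \<Rightarrow> ('b::metric_space \<Rightarrow> 'f::real_normed_vector)"
  assumes X: "finite X" and Y: "finite Y" and \<psi>: "bij_betw \<psi> Y X"
    and \<Phi>: "\<And>y. y \<in> Y \<Longrightarrow> bij (\<Phi> y)"
    and T: "T \<in> UC_space X \<rightarrow> Lip_space Y"
    and rep: "\<And>f y. f \<in> UC_space X \<Longrightarrow> y \<in> Y \<Longrightarrow> T f y = \<Phi> y (f (\<psi> y))"
  shows "biseparating X (UC_space X) Y (Lip_space Y) T"
proof -
  have A: "UC_space X = (extensional X :: ('a \<Rightarrow> 'e) set)" by (rule UC_space_finite[OF X])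
  have B: "Lip_space Y = (extensional Y :: ('b \<Rightarrow> 'f) set)" by (rule Lip_space_finite[OF Y])
  have eq: "T f y = T h y \<longleftrightarrow> f (\<psi> y) = h (\<psi> y)"
    if "f \<in> UC_space X" "h \<in> UC_space X" "y \<in> Y" for f h y
    using rep that \<Phi>[OF that(3)] by (metis bij_pointE)
  have all: "(\<forall>x\<in>X. P x) \<longleftrightarrow> (\<forall>y\<in>Y. P (\<psi> y))" for P
    using \<psi> by (metis bij_betw_def imageE imageI)
  have "inj_on T (UC_space X)"
  proof (rule inj_onI)
    fix f h assume fh: "f \<in> UC_space X" "h \<in> UC_space X" "T f = T h"
    then have "\<forall>x\<in>X. f x = h x" unfolding all using eq by metis
    then show "f = h" using fh by (auto simp: A intro: extensionalityI)
  qed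
  moreover have "g \<in> T ` UC_space X" if g: "g \<in> Lip_space Y" for g
  proof -
    define f where "f = (\<lambda>x\<in>X. inv (\<Phi> (inv_into Y \<psi> x)) (g (inv_into Y \<psi> x)))"
    have f: "f \<in> UC_space X" by (simp add: A f_def)
    have "T f y = g y" if "y \<in> Y" for y
      using rep[OF f that] that bij_betw_inv_into_left[OF \<psi> that] bij_betw_apply[OF \<psi> that]
        surj_f_inv_f[OF bij_is_surj[OF \<Phi>[OF that]]]
      by (simp add: f_def)
    then have "T f = g" using T f g by (auto simp: B intro: extensionalityI)
    then show ?thesis using f by blast
  qed
  ultimately have "bij_betw T (UC_space X) (Lip_space Y)"
    using T by (auto simp: bij_betw_def)
  moreover have "perp_at X h f g \<longleftrightarrow> perp_at Y (T h) (T f) (T g)"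
    if fgh: "f \<in> UC_space X" "g \<in> UC_space X" "h \<in> UC_space X" for f g h
    unfolding perp_at_iff all using eq fgh by blast
  ultimately show ?thesis by (simp add: biseparating_def)
qed

section \<open>Sparse subsequences and distances\<close>

text \<open>Diagonal choice of a subsequence in which every term is late enough relative to all
  previously chosen terms.\<close>

lemma ex_strict_mono_eventually:
  assumes "\<And>j m k. \<forall>\<^sub>F n in sequentially. P j m k n"
  shows "\<exists>r :: nat \<Rightarrow> nat. strict_mono r \<and> (\<forall>k. N k \<le> r k) \<and> (\<forall>j k. j < k \<longrightarrow> P j (r j) k (r k))"
proof -
  have "\<exists>r. \<forall>k. N k \<le> r k \<and> (r k < r (Suc k) \<and> (\<forall>j\<le>k. \<forall>m\<le>r k. P j m (Suc k) (r (Suc k))))"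
  proof (rule dependent_nat_choice)
    fix x k :: nat
    have "\<forall>\<^sub>F n in sequentially. \<forall>j\<in>{..k}. \<forall>m\<in>{..x}. P j m (Suc k) n"
      by (intro eventually_ball_finite ballI finite_atMost assms)
    moreover have "\<forall>\<^sub>F n in sequentially. N (Suc k) \<le> n" "\<forall>\<^sub>F n in sequentially. x < n"
      by (auto intro: eventually_ge_at_top eventually_gt_at_top)
    ultimately have "\<forall>\<^sub>F n in sequentially.
        N (Suc k) \<le> n \<and> x < n \<and> (\<forall>j\<in>{..k}. \<forall>m\<in>{..x}. P j m (Suc k) n)"
      by eventually_elim blast
    then show "\<exists>n. N (Suc k) \<le> n \<and> (x < n \<and> (\<forall>j\<le>k. \<forall>m\<le>x. P j m (Suc k) n))"
      by (auto simp: eventually_sequentially)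
  qed blast
  then obtain r where r: "\<And>k. N k \<le> r k" "\<And>k. r k < r (Suc k)"
    "\<And>k j m. j \<le> k \<Longrightarrow> m \<le> r k \<Longrightarrow> P j m (Suc k) (r (Suc k))"
    by blast
  have sm: "strict_mono r" using r(2) by (simp add: strict_mono_Suc_iff)
  have "P j (r j) k (r k)" if "j < k" for j k
  proof -
    obtain i where "k = Suc i" "j \<le> i" using \<open>j < k\<close> by (cases k) auto
    then show ?thesis using r(3)[of j i "r j"] sm by (simp add: strict_mono_less_eq)
  qed
  then show ?thesis using sm r(1) by blast
qed

lemma less_infdistD:
  assumes "infdist x A < e" and "A \<noteq> {}"
  shows "\<exists>a\<in>A. dist x a < e"
proof (rule ccontr)
  assume "\<not> ?thesis"
  then have "e \<le> infdist x A"
    unfolding infdist_notempty[OF assms(2)] by (intro cINF_greatest assms(2)) (auto simp: not_less)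
  then show False using assms(1) by simp
qed

section \<open>Normalized biseparating maps\<close>

text \<open>The vector \<open>v\<close> is the direction in which the hills point; taking it of norm \<open>1\<close> makes norms of
  images equal to heights.\<close>

locale normalized_biseparating =
  fixes X :: "'a::metric_space set" and Y :: "'b::metric_space set"
    and T :: "('a \<Rightarrow> 'e::real_normed_vector) \<Rightarrow> ('b \<Rightarrow> 'f::real_normed_vector)"
    and v :: 'f
  assumes biseparating: "biseparating X (UC_space X) Y (Lip_space Y) T"
    and zero: "T (\<lambda>x\<in>X. 0) = (\<lambda>y\<in>Y. 0)"
    and bounded: "bounded Y"
    and norm_v: "norm v = 1"
begin

lemma perp: "f \<in> UC_space X \<Longrightarrow> g \<in> UC_space X \<Longrightarrow> h \<in> UC_space X \<Longrightarrow>
      (\<forall>x\<in>X. f x = h x \<or> g x = h x) \<longleftrightarrow> (\<forall>y\<in>Y. T f y = T h y \<or> T g y = T h y)"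
  using biseparating unfolding biseparating_def perp_at_iff by blast

lemma bij: "bij_betw T (UC_space X) (Lip_space Y)"
  using biseparating by (simp add: biseparating_def)

lemma T_in: "f \<in> UC_space X \<Longrightarrow> T f \<in> Lip_space Y"
  using bij by (rule bij_betw_apply)

definition S :: "('b \<Rightarrow> 'f) \<Rightarrow> ('a \<Rightarrow> 'e)" where "S = inv_into (UC_space X) T"

lemma S_in: "g \<in> Lip_space Y \<Longrightarrow> S g \<in> UC_space X"
  unfolding S_def using bij by (metis bij_betw_def inv_into_into)

lemma T_S: "g \<in> Lip_space Y \<Longrightarrow> T (S g) = g"
  unfolding S_def using bij by (rule bij_betw_inv_into_right)

lemma disjoint_iff:
  assumes "f \<in> UC_space X" and "g \<in> UC_space X"
  shows "(\<forall>x\<in>X. f x = 0 \<or> g x = 0) \<longleftrightarrow> (\<forall>y\<in>Y. T f y = 0 \<or> T g y = 0)"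
  using perp[OF assms zero_in_UC_space] by (simp add: zero)

text \<open>This is separation of \<open>0\<close> and \<open>g\<close> at the base \<open>f\<close>. Disjointness alone sees only supports; through this
  relation the values of \<open>T g\<close> become accessible.\<close>

lemma restriction_iff:
  assumes "f \<in> UC_space X" and "g \<in> UC_space X"
  shows "(\<forall>x\<in>X. f x = 0 \<or> f x = g x) \<longleftrightarrow> (\<forall>y\<in>Y. T f y = 0 \<or> T f y = T g y)"
proof -
  have "(\<forall>x\<in>X. f x = 0 \<or> f x = g x) \<longleftrightarrow> (\<forall>x\<in>X. (\<lambda>x\<in>X. 0) x = f x \<or> g x = f x)" by auto
  also have "\<dots> \<longleftrightarrow> (\<forall>y\<in>Y. (\<lambda>y\<in>Y. 0) y = T f y \<or> T g y = T f y)"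
    using perp[OF zero_in_UC_space assms(2,1)] by (simp only: zero)
  also have "\<dots> \<longleftrightarrow> (\<forall>y\<in>Y. T f y = 0 \<or> T f y = T g y)" by auto
  finally show ?thesis .
qed

end

section \<open>Transporting hills along a sequence of disjoint functions\<close>

locale disjoint_sequence = normalized_biseparating X Y T v
  for X :: "'a::metric_space set" and Y :: "'b::metric_space set"
    and T :: "('a \<Rightarrow> 'e::real_normed_vector) \<Rightarrow> ('b \<Rightarrow> 'f::real_normed_vector)" and v +
  fixes u :: "nat \<Rightarrow> 'a \<Rightarrow> 'e"
  assumes u_in: "u n \<in> UC_space X"
    and u_nonzero: "\<exists>x\<in>X. u n x \<noteq> 0"
    and u_disjoint: "m \<noteq> n \<Longrightarrow> x \<in> X \<Longrightarrow> u m x = 0 \<or> u n x = 0"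
begin

definition V :: "nat \<Rightarrow> 'b set" where "V n = {y \<in> Y. T (u n) y \<noteq> 0}"

definition depth :: "nat \<Rightarrow> 'b \<Rightarrow> real" where "depth n y = infdist y (Y - V n)"

definition hill :: "nat \<Rightarrow> real \<Rightarrow> 'b \<Rightarrow> 'f" where
  "hill n c = (\<lambda>y\<in>Y. (c * depth n y) *\<^sub>R v)"

definition range_of_hills :: "real \<Rightarrow> 'b \<Rightarrow> 'f" where
  "range_of_hills c = (\<lambda>y\<in>Y. (c * glue depth y) *\<^sub>R v)"

definition pre :: "nat \<Rightarrow> real \<Rightarrow> 'a \<Rightarrow> 'e" where "pre n c = S (hill n c)"

lemma V_disjoint: "m \<noteq> n \<Longrightarrow> V m \<inter> V n = {}"
  using disjoint_iff[OF u_in[of m] u_in[of n]] u_disjoint[of m n] by (auto simp: V_def)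

lemma V_nonempty: "V n \<noteq> {}"
proof
  assume "V n = {}"
  then have "\<forall>y\<in>Y. T (u n) y = 0 \<or> T (u n) y = 0" by (auto simp: V_def)
  then show False using disjoint_iff[OF u_in[of n] u_in[of n]] u_nonzero[of n] by blast
qed

lemma V_subset: "V n \<subseteq> Y" by (auto simp: V_def)

lemma complement_nonempty: "Y - V n \<noteq> {}"
  using V_nonempty[of "Suc n"] V_disjoint[of n "Suc n"] V_subset[of "Suc n"] by auto

lemma depth_nonneg: "0 \<le> depth n y"
  by (simp add: depth_def infdist_nonneg)

lemma depth_le_dist: "z \<in> Y \<Longrightarrow> z \<notin> V n \<Longrightarrow> depth n y \<le> dist y z"
  by (auto simp: depth_def intro: infdist_le)

lemma depth_eq_0: "y \<in> Y \<Longrightarrow> y \<notin> V n \<Longrightarrow> depth n y = 0"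
  by (simp add: depth_def)

lemma depth_pos:
  assumes y: "y \<in> V n"
  shows "0 < depth n y"
proof -
  have "continuous_on Y (T (u n))"
    using T_in[OF u_in[of n]] by (auto simp: Lip_space_def intro: lipschitz_on_continuous_on)
  moreover have "y \<in> Y" "0 < norm (T (u n) y)" using y by (auto simp: V_def)
  ultimately obtain d where d: "0 < d"
    "\<And>z. z \<in> Y \<Longrightarrow> dist z y < d \<Longrightarrow> dist (T (u n) z) (T (u n) y) < norm (T (u n) y)"
    unfolding continuous_on_iff by metis
  have "d \<le> dist y z" if "z \<in> Y - V n" for z
    using d(2)[of z] that by (force simp: V_def dist_commute)
  then have "d \<le> depth n y"
    unfolding depth_def infdist_notempty[OF complement_nonempty]
    by (intro cINF_greatest complement_nonempty) auto
  then show ?thesis using d(1) by simp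
qed

lemma depth_disjoint: "y \<in> Y \<Longrightarrow> m \<noteq> n \<Longrightarrow> depth m y = 0 \<or> depth n y = 0"
  using depth_eq_0 V_disjoint by blast

lemma glue_depth: "y \<in> Y \<Longrightarrow> depth n y \<noteq> 0 \<Longrightarrow> glue depth y = depth n y"
  using glue_eq[of depth y n] depth_disjoint by blast

lemma depth_lipschitz: "depth n y - depth n z \<le> dist y z"
  unfolding depth_def using infdist_triangle_abs[of y "Y - V n" z] by linarith

lemma hill_in: "0 < c \<Longrightarrow> hill n c \<in> Lip_space Y"
proof -
  assume "0 < c"
  have "\<bar>c * depth n y - c * depth n z\<bar> \<le> c * dist y z" for y z
    using depth_lipschitz[of n y z] depth_lipschitz[of n z y] \<open>0 < c\<close>
    by (simp add: abs_mult right_diff_distrib[symmetric] dist_commute abs_le_iff)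
  then show ?thesis
    unfolding hill_def using \<open>0 < c\<close> by (intro Lip_space_scaleR[of c]) auto
qed

text \<open>The gluing is the pointwise maximum of the depths, hence as Lipschitz as each of them.\<close>

lemma range_of_hills_in:
  assumes "0 < c"
  shows "range_of_hills c \<in> Lip_space Y"
proof -
  have max: "depth n z \<le> glue depth z" if "z \<in> Y" for n z
    using glue_depth[OF that, of n] depth_nonneg[of _ z] by (cases "depth n z = 0") (auto simp: glue_def)
  have one_sided: "glue depth y - glue depth z \<le> dist y z" if "y \<in> Y" "z \<in> Y" for y z
  proof (cases "\<exists>n. depth n y \<noteq> 0")
    case True
    then obtain n where "depth n y \<noteq> 0" by blast
    then show ?thesis
      using glue_depth[OF that(1), of n] max[OF that(2), of n] depth_lipschitz[of n y z] by simp
  next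
    case False
    then have "glue depth y = 0" by (simp add: glue_def)
    then show ?thesis using max[OF that(2), of 0] depth_nonneg[of 0 z] zero_le_dist[of y z] by linarith
  qed
  have "\<bar>c * glue depth y - c * glue depth z\<bar> \<le> c * dist y z" if "y \<in> Y" "z \<in> Y" for y z
    using one_sided[OF that] one_sided[OF that(2,1)] assms
    by (simp add: abs_mult right_diff_distrib[symmetric] dist_commute abs_le_iff)
  then show ?thesis
    unfolding range_of_hills_def using assms by (intro Lip_space_scaleR[of c]) auto
qed

lemma pre_in: "0 < c \<Longrightarrow> pre n c \<in> UC_space X"
  by (simp add: pre_def S_in hill_in)

lemma T_pre: "0 < c \<Longrightarrow> T (pre n c) = hill n c"
  by (simp add: pre_def T_S hill_in)

lemma pre_disjoint:
  assumes "m \<noteq> n" and "0 < c" and "0 < d" and "x \<in> X"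
  shows "pre m c x = 0 \<or> pre n d x = 0"
proof -
  have "\<forall>y\<in>Y. hill m c y = 0 \<or> hill n d y = 0"
    using depth_disjoint[OF _ assms(1)] by (auto simp: hill_def)
  then show ?thesis
    using disjoint_iff[OF pre_in[OF assms(2), of m] pre_in[OF assms(3), of n]] T_pre assms by simp
qed

text \<open>Supports on \<open>X\<close> are compared through disjointness only: whatever avoids \<open>u n\<close> avoids every preimage of a
  hill over \<open>V n\<close>. Applied to bumps \<open>w\<close>, this confines the support of \<open>pre n c\<close> to the closure of that of
  \<open>u n\<close>.\<close>

lemma pre_disjoint_from:
  fixes w :: "'a \<Rightarrow> 'e"
  assumes "0 < c" and "w \<in> UC_space X" and "\<And>x. x \<in> X \<Longrightarrow> w x = 0 \<or> u n x = 0" and "x \<in> X"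
  shows "w x = 0 \<or> pre n c x = 0"
proof -
  have "\<forall>y\<in>Y. T w y = 0 \<or> T (u n) y = 0"
    using disjoint_iff[OF assms(2) u_in[of n]] assms(3) by blast
  then have "\<forall>y\<in>Y. T w y = 0 \<or> T (pre n c) y = 0"
    unfolding T_pre[OF assms(1)] using depth_eq_0 by (fastforce simp: hill_def V_def)
  then show ?thesis using disjoint_iff[OF assms(2) pre_in[OF assms(1), of n]] assms(4) by blast
qed

lemma S_range_of_hills_disjoint_from:
  fixes w :: "'a \<Rightarrow> 'e"
  assumes "0 < c" and "w \<in> UC_space X" and "\<And>n x. x \<in> X \<Longrightarrow> w x = 0 \<or> u n x = 0" and "x \<in> X"
  shows "w x = 0 \<or> S (range_of_hills c) x = 0"
proof -
  have "T w y = 0 \<or> range_of_hills c y = 0" if "y \<in> Y" for y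
  proof (cases "T w y = 0")
    case False
    have "depth n y = 0" for n
      using disjoint_iff[OF assms(2) u_in[of n]] assms(3) depth_eq_0 that False
      by (auto simp: V_def)
    then have "glue depth y = 0" by (simp add: glue_def)
    then show ?thesis using that by (simp add: range_of_hills_def)
  qed simp
  then show ?thesis
    using disjoint_iff[OF assms(2) S_in[OF range_of_hills_in[OF assms(1)]]] assms(1,4)
    by (auto simp: T_S range_of_hills_in)
qed

text \<open>One uniformly continuous function has all \<open>pre n c\<close> with the same slope \<open>c\<close> as
  restrictions, so they share its modulus of continuity where they do not vanish.\<close>

lemma pre_restricts_S_range_of_hills:
  assumes "0 < c" and "x \<in> X"
  shows "pre n c x = 0 \<or> pre n c x = S (range_of_hills c) x"
proof -
  have "hill n c y = 0 \<or> hill n c y = range_of_hills c y" if "y \<in> Y" for y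
    using that glue_depth[OF that, of n] by (auto simp: hill_def range_of_hills_def)
  then show ?thesis
    using restriction_iff[OF pre_in[OF assms(1)] S_in[OF range_of_hills_in[OF assms(1)]], of n] assms
    by (auto simp: T_S range_of_hills_in T_pre)
qed

text \<open>On the supports \<open>V (r k)\<close> the image is forced because each summand is a restriction of the sum. At a
  point away from all of them a bump exists that is disjoint from all hills, and this transports to
  \<open>X\<close> and back. Boundary points of the union are accessible only through nearby points.\<close>

lemma T_glued:
  assumes C: "\<And>k. 0 < C k" and r: "strict_mono r"
    and f: "f \<in> UC_space X" "\<forall>x\<in>X. f x = glue (\<lambda>k. pre (r k) (C k)) x"
  shows T_glued_on_V: "y \<in> V (r k) \<Longrightarrow> T f y = (C k * depth (r k) y) *\<^sub>R v"
    and T_glued_away: "z \<in> Y \<Longrightarrow> 0 < d \<Longrightarrow> (\<And>k y. y \<in> V (r k) \<Longrightarrow> d \<le> dist y z) \<Longrightarrow> T f z = 0"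
proof -
  have disj: "pre (r i) (C i) x = 0 \<or> pre (r j) (C j) x = 0" if "i \<noteq> j" "x \<in> X" for i j x
    using pre_disjoint C r that strict_mono_eq by blast
  have f_eq: "f x = pre (r k) (C k) x" if "x \<in> X" "pre (r k) (C k) x \<noteq> 0" for x k
    using f(2) glue_eq[of "\<lambda>k. pre (r k) (C k)" x k] disj that by auto
  show "T f y = (C k * depth (r k) y) *\<^sub>R v" if y: "y \<in> V (r k)"
  proof -
    have "\<forall>x\<in>X. pre (r k) (C k) x = 0 \<or> pre (r k) (C k) x = f x" using f_eq by metis
    then have "hill (r k) (C k) y = 0 \<or> hill (r k) (C k) y = T f y"
      using restriction_iff[OF pre_in[OF C, of "r k" k] f(1)] T_pre[OF C]
        y V_subset[of "r k"] by auto
    moreover have "hill (r k) (C k) y = (C k * depth (r k) y) *\<^sub>R v" "v \<noteq> 0"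
      using y V_subset norm_v by (auto simp: hill_def)
    ultimately show ?thesis using depth_pos[OF y] C[of k] by auto
  qed
  show "T f z = 0" if z: "z \<in> Y" "0 < d" "\<And>k y. y \<in> V (r k) \<Longrightarrow> d \<le> dist y z"
  proof -
    have "v \<noteq> 0" using norm_v by auto
    then obtain g where g: "g \<in> Lip_space Y" "g z \<noteq> (0::'f)" "\<And>y. y \<in> Y \<Longrightarrow> d \<le> dist y z \<Longrightarrow> g y = 0"
      using ex_Lip_space_bump[OF z(1,2)] by blast
    have "S g x = 0 \<or> pre (r k) (C k) x = 0" if "x \<in> X" for x k
    proof -
      have "\<forall>y\<in>Y. g y = 0 \<or> hill (r k) (C k) y = 0"
        using g(3) z(3)[of _ k] depth_eq_0[of _ "r k"] by (auto simp: hill_def)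
      then show ?thesis
        using disjoint_iff[OF S_in[OF g(1)] pre_in[OF C, of "r k" k]] that T_S[OF g(1)] T_pre[OF C] by simp
    qed
    then have "\<forall>x\<in>X. S g x = 0 \<or> f x = 0"
      using f(2) by (auto simp: glue_def)
    then show ?thesis
      using disjoint_iff[OF S_in[OF g(1)] f(1)] T_S[OF g(1)] g(2) z(1) by auto
  qed
qed

text \<open>If infinitely many of the \<open>V n\<close> contain hills of slope \<open>1\<close> and height more than a fixed \<open>\<epsilon>\<close>, slopes tending to
  infinity make the image unbounded. Otherwise the depths tend to \<open>0\<close> uniformly. Then with
  slopes \<open>4 ^ k\<close> and a sparse choice of indices, the hill over \<open>V (r k)\<close> keeps half of its height against
  everything nearby: the hills chosen later are lower than half of it, and those chosen earlier
  have at most a quarter of its slope, so that they cannot rise high within twice the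
  distance from its summit to its boundary.\<close>

lemma not_gluable:
  assumes gluable: "\<And>C. (\<And>k. 0 < C k) \<Longrightarrow> \<exists>N. \<forall>r. strict_mono r \<longrightarrow> (\<forall>k. N k \<le> r k) \<longrightarrow>
    (\<lambda>x\<in>X. glue (\<lambda>k. pre (r k) (C k)) x) \<in> UC_space X"
  shows False
proof (cases "\<forall>\<epsilon>>0. \<forall>\<^sub>F n in sequentially. \<forall>y\<in>Y. depth n y \<le> \<epsilon>")
  case False
  then obtain \<epsilon> where \<epsilon>: "0 < \<epsilon>" "\<exists>\<^sub>F n in sequentially. \<exists>y\<in>Y. \<epsilon> < depth n y"
    by (auto simp: not_eventually not_le)
  have C: "0 < real (Suc k)" for k by simp
  obtain N where N: "\<And>r. strict_mono r \<Longrightarrow> (\<And>k. N k \<le> r k) \<Longrightarrow>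
    (\<lambda>x\<in>X. glue (\<lambda>k. pre (r k) (Suc k)) x) \<in> UC_space X"
    using gluable[of "\<lambda>k. real (Suc k)", OF C] by blast
  have deep: "\<exists>n\<ge>M. \<exists>y\<in>Y. \<epsilon> < depth n y" for M
    using \<epsilon>(2) unfolding frequently_sequentially by blast
  have "\<exists>r. \<forall>k. (N k \<le> r k \<and> (\<exists>y\<in>Y. \<epsilon> < depth (r k) y)) \<and> r k < r (Suc k)"
  proof (rule dependent_nat_choice)
    show "\<exists>n. N 0 \<le> n \<and> (\<exists>y\<in>Y. \<epsilon> < depth n y)" using deep by blast
    show "\<exists>n. (N (Suc k) \<le> n \<and> (\<exists>y\<in>Y. \<epsilon> < depth n y)) \<and> m < n" for m k
      using deep[of "max (N (Suc k)) (Suc m)"] by (auto simp: Suc_le_eq)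
  qed
  then obtain r where r: "\<And>k. N k \<le> r k" "\<And>k. \<exists>y\<in>Y. \<epsilon> < depth (r k) y" "\<And>k. r k < r (Suc k)"
    by blast
  have sm: "strict_mono r" using r(3) by (simp add: strict_mono_Suc_iff)
  define f where "f = (\<lambda>x\<in>X. glue (\<lambda>k. pre (r k) (Suc k)) x)"
  have f: "f \<in> UC_space X" unfolding f_def by (rule N[OF sm r(1)])
  have f_glue: "\<forall>x\<in>X. f x = glue (\<lambda>k. pre (r k) (real (Suc k))) x"
    by (simp add: f_def)
  obtain B where B: "\<And>y. y \<in> Y \<Longrightarrow> norm (T f y) \<le> B"
    using Lip_space_bounded[OF T_in[OF f] bounded] by (auto simp: bounded_iff)
  obtain k :: nat where k: "B < real k * \<epsilon>" using \<epsilon>(1) reals_Archimedean3 by blast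
  obtain y where y: "y \<in> Y" "\<epsilon> < depth (r k) y" using r(2) by blast
  have "y \<in> V (r k)" using y \<epsilon>(1) depth_eq_0[OF y(1), of "r k"] by fastforce
  then have "T f y = (Suc k * depth (r k) y) *\<^sub>R v"
    by (rule T_glued_on_V[where C = "\<lambda>k. real (Suc k)", OF C sm f f_glue])
  then have "norm (T f y) = Suc k * depth (r k) y" using y \<epsilon>(1) norm_v by simp
  also have "\<dots> \<ge> real k * \<epsilon>" using y(2) \<epsilon>(1) by (intro mult_mono) auto
  finally show False using B[OF y(1)] k by simp
next
  case True
  obtain p where p: "\<And>n. p n \<in> V n" using V_nonempty by (meson ex_in_conv)
  have C: "0 < (4::real) ^ k" for k by simp
  obtain N where N: "\<And>r. strict_mono r \<Longrightarrow> (\<And>k. N k \<le> r k) \<Longrightarrow>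
    (\<lambda>x\<in>X. glue (\<lambda>k. pre (r k) (4 ^ k)) x) \<in> UC_space X"
    using gluable[of "\<lambda>k. 4 ^ k", OF C] by blast
  have "\<forall>\<^sub>F n in sequentially. \<forall>y\<in>Y. 4 ^ k * depth n y \<le> 4 ^ j * depth m (p m) / 2" for j m k :: nat
  proof -
    have "0 < 4 ^ j * depth m (p m) / 2 / 4 ^ k" using depth_pos[OF p[of m]] by simp
    then have "\<forall>\<^sub>F n in sequentially. \<forall>y\<in>Y. depth n y \<le> 4 ^ j * depth m (p m) / 2 / 4 ^ k"
      using True by blast
    then show ?thesis by eventually_elim (simp add: field_simps)
  qed
  from ex_strict_mono_eventually[where P = "\<lambda>j m k n. \<forall>y\<in>Y. 4 ^ k * depth n y \<le> 4 ^ j * depth m (p m) / 2",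
      OF this, of N]
  obtain r where r: "strict_mono r" "\<forall>k. N k \<le> r k" and
    later: "\<forall>j k. j < k \<longrightarrow> (\<forall>y\<in>Y. 4 ^ k * depth (r k) y \<le> 4 ^ j * depth (r j) (p (r j)) / 2)"
    by (elim exE conjE)
  define f where "f = (\<lambda>x\<in>X. glue (\<lambda>k. pre (r k) (4 ^ k)) x)"
  have f: "f \<in> UC_space X" unfolding f_def using N[OF r(1)] r(2) by blast
  have f_glue: "\<forall>x\<in>X. f x = glue (\<lambda>k. pre (r k) (4 ^ k)) x"
    by (simp add: f_def)
  have norm_on_V: "norm (T f y) = 4 ^ k * depth (r k) y" if "y \<in> V (r k)" for y k
    using T_glued_on_V[where C = "\<lambda>k. 4 ^ k", OF C r(1) f f_glue that] depth_nonneg norm_v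
    by simp
  obtain L where L: "L-lipschitz_on Y (T f)" using T_in[OF f] by (auto simp: Lip_space_def)
  obtain k where k: "4 * L < 4 ^ k" using real_arch_pow[of 4 "4 * L"] by auto
  define y where "y = p (r k)"
  define \<rho> where "\<rho> = depth (r k) y"
  have y: "y \<in> V (r k)" "y \<in> Y" using p V_subset by (auto simp: y_def)
  have \<rho>: "0 < \<rho>" using depth_pos[OF y(1)] by (simp add: \<rho>_def)
  \<comment> \<open>The point \<open>z\<close> almost realizes the distance from \<open>y\<close> to the complement of \<open>V (r k)\<close>. It may lie on the boundary
    of the union of the supports, where the value of \<open>T f\<close> is not known directly; in that case a point \<open>w\<close> of
    some support within \<open>\<rho> / 8\<close> replaces it.\<close>
  have "infdist y (Y - V (r k)) < 3/2 * \<rho>" using \<rho> by (simp add: \<rho>_def depth_def)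
  then obtain z where z: "z \<in> Y" "z \<notin> V (r k)" "dist y z < 3/2 * \<rho>"
    using less_infdistD complement_nonempty by blast
  obtain w where w: "w \<in> Y" "dist y w \<le> 2 * \<rho>" "norm (T f w) \<le> 4 ^ k * \<rho> / 2"
  proof (cases "\<forall>j. \<forall>w\<in>V (r j). \<rho> / 8 \<le> dist w z")
    case True
    then have "T f z = 0"
      using T_glued_away[where C = "\<lambda>k. 4 ^ k", OF C r(1) f f_glue z(1), of "\<rho> / 8"] \<rho> by auto
    then show ?thesis using that[of z] z \<rho> by auto
  next
    case False
    then obtain j w where w: "w \<in> V (r j)" "dist w z < \<rho> / 8" by (auto simp: not_le)
    have wY: "w \<in> Y" using w V_subset by auto
    have yw: "dist y w \<le> 2 * \<rho>"
      using dist_triangle[of y w z] w(2) z(3) \<rho> by (simp add: dist_commute)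
    have "4 ^ j * depth (r j) w \<le> 4 ^ k * \<rho> / 2"
    proof (cases j k rule: linorder_cases)
      case less
      then have "(4::real) ^ Suc j \<le> 4 ^ k" by (intro power_increasing) auto
      moreover have "y \<notin> V (r j)"
        using V_disjoint[of "r j" "r k"] strict_mono_eq[OF r(1), of j k] less y(1) by auto
      then have "depth (r j) w \<le> 2 * \<rho>"
        using depth_le_dist[OF y(2), of "r j" w] yw by (simp add: dist_commute)
      ultimately have "4 ^ Suc j * depth (r j) w \<le> 4 ^ k * (2 * \<rho>)"
        using depth_nonneg by (intro mult_mono) auto
      then show ?thesis by (simp add: algebra_simps)
    next
      case equal
      then have "depth (r j) w \<le> \<rho> / 8" using depth_le_dist[OF z(1,2), of w] w(2) by simp
      then have "depth (r j) w \<le> \<rho> / 2" using \<rho> by simp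
      then show ?thesis using equal mult_left_mono[of "depth (r j) w" "\<rho> / 2" "4 ^ k"] by simp
    next
      case greater
      then show ?thesis using later greater wY by (simp add: \<rho>_def y_def)
    qed
    then show ?thesis using that[OF wY yw] norm_on_V[OF w(1)] by simp
  qed
  have "norm (T f y) = 4 ^ k * \<rho>" using norm_on_V[OF y(1)] by (simp add: \<rho>_def)
  then have "4 ^ k * \<rho> / 2 \<le> dist (T f y) (T f w)"
    using norm_triangle_ineq2[of "T f y" "T f w"] w(3) by (simp add: dist_norm)
  also have "\<dots> \<le> L * dist y w" by (rule lipschitz_onD[OF L y(2) w(1)])
  also have "\<dots> \<le> L * (2 * \<rho>)" using w(2) lipschitz_on_nonneg[OF L] by (intro mult_left_mono)
  finally have "4 ^ k * \<rho> \<le> (4 * L) * \<rho>" by simp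
  then show False using k \<rho> by simp
qed

end

section \<open>Infinite domains\<close>

lemma tendsto_zero_if_halving:
  fixes t :: "nat \<Rightarrow> real"
  assumes "\<And>n. 0 \<le> t n" and "\<And>n. t (Suc n) \<le> t n / 2"
  shows "t \<longlonglongrightarrow> 0"
proof -
  have "t n \<le> t 0 * (1/2) ^ n" for n
  proof (induction n)
    case (Suc n)
    then show ?case using assms(2)[of n] by simp
  qed simp
  moreover have "(\<lambda>n. t 0 * (1/2) ^ n) \<longlonglongrightarrow> t 0 * 0"
    by (intro tendsto_intros LIMSEQ_realpow_zero) auto
  ultimately show ?thesis
    using assms(1)
    by (intro tendsto_sandwich[where f = "\<lambda>_. 0" and g = t and h = "\<lambda>n. t 0 * (1/2) ^ n"])
      (auto intro!: always_eventually)
qed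

text \<open>If \<open>X\<close> has an accumulation point, take a sequence converging to it geometrically and call its terms
  \<open>a\<close> and \<open>b\<close> alternately. If all points of \<open>X\<close> are isolated, the balls can be single points, and it
  suffices that the pairs do not repeat points: two distinct points closer together than the isolation
  radius of an earlier point must both differ from it.\<close>

lemma ex_disjoint_close_balls:
  fixes X :: "'a::metric_space set"
  assumes close: "\<And>\<epsilon>. 0 < \<epsilon> \<Longrightarrow> \<exists>x\<in>X. \<exists>y\<in>X. x \<noteq> y \<and> dist x y < \<epsilon>"
  obtains a b :: "nat \<Rightarrow> 'a" and \<alpha> \<beta> :: "nat \<Rightarrow> real" where
    "\<And>n. a n \<in> X" "\<And>n. b n \<in> X" "\<And>n. 0 < \<alpha> n" "\<And>n. 0 < \<beta> n"
    "\<And>m n. m \<noteq> n \<Longrightarrow> X \<inter> ball (a m) (\<alpha> m) \<inter> ball (a n) (\<alpha> n) = {}"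
    "\<And>m n. X \<inter> ball (a m) (\<alpha> m) \<inter> ball (b n) (\<beta> n) = {}"
    "(\<lambda>n. dist (a n) (b n)) \<longlonglongrightarrow> 0"
proof (cases "\<exists>x0\<in>X. x0 islimpt X")
  case True
  then obtain x0 where x0: "x0 islimpt X" by blast
  have "\<exists>c. \<forall>n::nat. (c n \<in> X \<and> c n \<noteq> x0) \<and> dist (c (Suc n)) x0 < dist (c n) x0 / 2"
  proof (rule dependent_nat_choice)
    show "\<exists>x. x \<in> X \<and> x \<noteq> x0" using x0 by (auto simp: islimpt_approachable intro: zero_less_one)
    show "\<exists>y. (y \<in> X \<and> y \<noteq> x0) \<and> dist y x0 < dist x x0 / 2" if "x \<in> X \<and> x \<noteq> x0" for x n
      using x0 that unfolding islimpt_approachable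
      by (metis half_gt_zero zero_less_dist_iff)
  qed
  then obtain c where c: "\<And>n. c n \<in> X" "\<And>n. c n \<noteq> x0" "\<And>n. dist (c (Suc n)) x0 < dist (c n) x0 / 2"
    by blast
  define d where "d n = dist (c n) x0" for n
  have d: "0 < d n" "d (Suc n) < d n / 2" for n using c by (simp_all add: d_def)
  have d_less: "d n < d m / 2" if "m < n" for m n
    using that
  proof (induction n)
    case (Suc n)
    then show ?case using d(2)[of n] d(1)[of n] by (cases "m = n") auto
  qed simp
  have disj: "X \<inter> ball (c m) (d m / 4) \<inter> ball (c n) (d n / 4) = {}" if "m \<noteq> n" for m n
  proof -
    have False if "m < n" "dist (c m) x < d m / 4" "dist (c n) x < d n / 4" for m n x
    proof -
      have "d m \<le> dist (c m) x + dist (c n) x + d n"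
        using dist_triangle[of "c m" x0 x] dist_triangle[of x x0 "c n"]
        unfolding d_def dist_commute[of "c n" x] by linarith
      then show False using d_less[OF that(1)] that(2,3) d(1)[of m] by linarith
    qed
    then show ?thesis using \<open>m \<noteq> n\<close> by (auto simp: neq_iff)
  qed
  have "d \<longlonglongrightarrow> 0" using d by (intro tendsto_zero_if_halving) (auto intro: less_imp_le)
  then have "(\<lambda>n. d (2 * n)) \<longlonglongrightarrow> 0" "(\<lambda>n. d (2 * n + 1)) \<longlonglongrightarrow> 0"
    using LIMSEQ_subseq_LIMSEQ[of d 0 "\<lambda>n. 2 * n"] LIMSEQ_subseq_LIMSEQ[of d 0 "\<lambda>n. 2 * n + 1"]
    by (simp_all add: comp_def strict_mono_def)
  from tendsto_add[OF this] have sum: "(\<lambda>n. d (2 * n) + d (2 * n + 1)) \<longlonglongrightarrow> 0" by simp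
  have lim: "(\<lambda>n. dist (c (2 * n)) (c (2 * n + 1))) \<longlonglongrightarrow> 0"
  proof (rule tendsto_sandwich[OF _ _ tendsto_const sum])
    show "\<forall>\<^sub>F n in sequentially. dist (c (2 * n)) (c (2 * n + 1)) \<le> d (2 * n) + d (2 * n + 1)"
      unfolding d_def by (intro always_eventually allI dist_triangle2)
  qed simp
  have odd: "2 * m \<noteq> 2 * n + 1" for m n :: nat by presburger
  show thesis
  proof (rule that[of "\<lambda>n. c (2 * n)" "\<lambda>n. c (2 * n + 1)" "\<lambda>n. d (2 * n) / 4" "\<lambda>n. d (2 * n + 1) / 4"])
    show "X \<inter> ball (c (2 * m)) (d (2 * m) / 4) \<inter> ball (c (2 * n)) (d (2 * n) / 4) = {}" if "m \<noteq> n" for m n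
      by (rule disj) (use that in simp)
    show "X \<inter> ball (c (2 * m)) (d (2 * m) / 4) \<inter> ball (c (2 * n + 1)) (d (2 * n + 1) / 4) = {}" for m n
      by (rule disj[OF odd])
    show "0 < d (2 * n) / 4" "0 < d (2 * n + 1) / 4" for n using d(1) by simp_all
  qed (rule c lim)+
next
  case False
  then have "\<forall>x\<in>X. \<exists>e>0. \<forall>y\<in>X. dist y x < e \<longrightarrow> y = x"
    unfolding islimpt_approachable by blast
  then obtain \<iota> where \<iota>: "\<And>x. x \<in> X \<Longrightarrow> 0 < \<iota> x" "\<And>x y. x \<in> X \<Longrightarrow> y \<in> X \<Longrightarrow> dist y x < \<iota> x \<Longrightarrow> y = x"
    by metis
  \<comment> \<open>The third component bounds how close the next pair has to be; it stays below the isolation radii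
    of all points chosen so far because it at least halves in each step.\<close>
  define P where "P p \<longleftrightarrow> (case p of (x, y, t) \<Rightarrow> x \<in> X \<and> y \<in> X \<and> x \<noteq> y \<and> 0 < t \<and> t \<le> \<iota> x \<and> t \<le> \<iota> y)"
    for p :: "'a \<times> 'a \<times> real"
  define Q where "Q p q \<longleftrightarrow> (case p of (x, y, t) \<Rightarrow> case q of (x', y', t') \<Rightarrow> dist x' y' < t \<and> t' \<le> t / 2)"
    for p q :: "'a \<times> 'a \<times> real"
  have "\<exists>s. \<forall>n::nat. P (s n) \<and> Q (s n) (s (Suc n))"
  proof (rule dependent_nat_choice)
    obtain x y where "x \<in> X" "y \<in> X" "x \<noteq> y" using close[OF zero_less_one] by blast
    then have "P (x, y, min (\<iota> x) (\<iota> y))" by (simp add: P_def \<iota>(1))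
    then show "\<exists>p. P p" by blast
  next
    fix p n assume p: "P p"
    obtain x y t where xyt: "p = (x, y, t)" by (cases p)
    then have "0 < t" using p by (simp add: P_def)
    then obtain x' y' where "x' \<in> X" "y' \<in> X" "x' \<noteq> y'" "dist x' y' < t" using close by blast
    then have "P (x', y', min (t / 2) (min (\<iota> x') (\<iota> y')))" "Q p (x', y', min (t / 2) (min (\<iota> x') (\<iota> y')))"
      using \<open>0 < t\<close> by (auto simp: P_def Q_def xyt \<iota>(1))
    then show "\<exists>q. P q \<and> Q p q" by blast
  qed
  then obtain s where s: "\<And>n. P (s n)" "\<And>n. Q (s n) (s (Suc n))" by blast
  define a where "a n = fst (s n)" for n
  define b where "b n = fst (snd (s n))" for n
  define t where "t n = snd (snd (s n))" for n
  have ab: "a n \<in> X" "b n \<in> X" "a n \<noteq> b n" "0 < t n" "t n \<le> \<iota> (a n)" "t n \<le> \<iota> (b n)" for n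
    using s(1)[of n] by (auto simp: P_def a_def b_def t_def split: prod.splits)
  have step: "dist (a (Suc n)) (b (Suc n)) < t n" "t (Suc n) \<le> t n / 2" for n
    using s(2)[of n] by (auto simp: Q_def a_def b_def t_def split: prod.splits)
  have "t (Suc n) \<le> t n" for n using step(2)[of n] ab(4)[of n] by simp
  then have t_mono: "t n \<le> t m" if "m \<le> n" for m n
    using that by (rule lift_Suc_antimono_le)
  have later: "dist (a n) (b n) < t m" if mn: "m < n" for m n
  proof -
    obtain i where "n = Suc i" "m \<le> i" using mn by (cases n) auto
    then show ?thesis using step(1)[of i] t_mono[of m i] by simp
  qed
  have fresh: "a n \<noteq> a m \<and> a n \<noteq> b m \<and> b n \<noteq> a m" if "m < n" for m n
  proof -
    have "dist (a n) (b n) < \<iota> (a m)" "dist (a n) (b n) < \<iota> (b m)"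
      using later[OF that] ab(5,6)[of m] by linarith+
    then show ?thesis
      using \<iota>(2)[OF ab(1)[of m] ab(2)[of n]] \<iota>(2)[OF ab(1)[of m] ab(1)[of n]]
        \<iota>(2)[OF ab(2)[of m] ab(2)[of n]] ab(3)[of n] dist_commute[of "a n" "b n"] by metis
  qed
  have distinct: "a m \<noteq> a n" if "m \<noteq> n" for m n
    using that fresh[of m n] fresh[of n m] by (cases "m < n") auto
  have ab_distinct: "a m \<noteq> b n" for m n
    using fresh[of m n] fresh[of n m] ab(3)[of n] by (cases m n rule: linorder_cases) auto
  have ball: "x = z" if "z \<in> X" "x \<in> X" "x \<in> ball z (\<iota> z)" for x z
    using \<iota>(2)[OF that(1,2)] that(3) by (simp add: dist_commute)
  have "t \<longlonglongrightarrow> 0" using step(2) ab(4) by (intro tendsto_zero_if_halving) (auto intro: less_imp_le)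
  have "(\<lambda>n. dist (a (Suc n)) (b (Suc n))) \<longlonglongrightarrow> 0"
  proof (rule tendsto_sandwich[OF _ _ tendsto_const \<open>t \<longlonglongrightarrow> 0\<close>])
    show "\<forall>\<^sub>F n in sequentially. dist (a (Suc n)) (b (Suc n)) \<le> t n"
      using step(1) by (intro always_eventually allI less_imp_le)
  qed simp
  then have lim: "(\<lambda>n. dist (a n) (b n)) \<longlonglongrightarrow> 0" by (rule LIMSEQ_imp_Suc)
  show thesis
  proof (rule that[of a b "\<lambda>n. \<iota> (a n)" "\<lambda>n. \<iota> (b n)"])
    show "X \<inter> ball (a m) (\<iota> (a m)) \<inter> ball (a n) (\<iota> (a n)) = {}" if "m \<noteq> n" for m n
      using ball[OF ab(1)[of m]] ball[OF ab(1)[of n]] distinct[OF that] by (intro equals0I) (metis IntD1 IntD2)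
    show "X \<inter> ball (a m) (\<iota> (a m)) \<inter> ball (b n) (\<iota> (b n)) = {}" for m n
      using ball[OF ab(1)[of m]] ball[OF ab(2)[of n]] ab_distinct[of m n] by (intro equals0I) (metis IntD1 IntD2)
  qed (use ab \<iota>(1) lim in auto)
qed

context normalized_biseparating
begin

text \<open>Here gluing is unrestricted, since every function on \<open>X\<close> is uniformly continuous.\<close>

lemma finite_uniformly_discrete_domain:
  assumes e: "(e::'e) \<noteq> 0" and \<epsilon>: "0 < \<epsilon>"
    and sep: "\<And>x y. x \<in> X \<Longrightarrow> y \<in> X \<Longrightarrow> x \<noteq> y \<Longrightarrow> \<epsilon> \<le> dist x y"
  shows "finite X"
proof (rule ccontr)
  assume "infinite X"
  then obtain a :: "nat \<Rightarrow> 'a" where a: "inj a" "range a \<subseteq> X"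
    using infinite_countable_subset by blast
  have A: "UC_space X = (extensional X :: ('a \<Rightarrow> 'e) set)"
    using UC_space_uniformly_discrete[OF \<epsilon> sep] by blast
  define u where "u n = (\<lambda>x\<in>X. if x = a n then e else 0)" for n
  interpret disjoint_sequence X Y T v u
  proof
    show "\<exists>x\<in>X. u n x \<noteq> 0" for n
      using a e by (intro bexI[of _ "a n"]) (auto simp: u_def)
    show "u m x = 0 \<or> u n x = 0" if "m \<noteq> n" "x \<in> X" for m n x
      using a(1) that by (auto simp: u_def dest: injD)
  qed (simp add: A u_def)
  show False by (rule not_gluable) (simp add: A)
qed

text \<open>The preimage \<open>F\<close> of all hills of slope \<open>c\<close> vanishes at the points \<open>b n\<close>, which come arbitrarily close to the
  supports of the \<open>u n\<close>. Its uniform continuity therefore forces its restrictions \<open>pre n c\<close> to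
  become uniformly small, for every slope \<open>c\<close>, and functions with arbitrary prescribed slopes can be glued
  along a sparse enough subsequence.\<close>

lemma no_clustering_domain:
  assumes e: "(e::'e) \<noteq> 0"
  assumes close: "\<And>\<epsilon>. 0 < \<epsilon> \<Longrightarrow> \<exists>x\<in>X. \<exists>y\<in>X. x \<noteq> y \<and> dist x y < \<epsilon>"
  shows False
proof (rule ex_disjoint_close_balls[of X])
  show "\<exists>x\<in>X. \<exists>y\<in>X. x \<noteq> y \<and> dist x y < \<epsilon>" if "0 < \<epsilon>" for \<epsilon>
    by (rule close[OF that])
next
  fix a b :: "nat \<Rightarrow> 'a" and \<alpha> \<beta> :: "nat \<Rightarrow> real"
  assume ab: "\<And>n. a n \<in> X" "\<And>n. b n \<in> X" "\<And>n. 0 < \<alpha> n" "\<And>n. 0 < \<beta> n"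
    and aa: "\<And>m n. m \<noteq> n \<Longrightarrow> X \<inter> ball (a m) (\<alpha> m) \<inter> ball (a n) (\<alpha> n) = {}"
    and abd: "\<And>m n. X \<inter> ball (a m) (\<alpha> m) \<inter> ball (b n) (\<beta> n) = {}"
    and lim: "(\<lambda>n. dist (a n) (b n)) \<longlonglongrightarrow> 0"
  have bump: "\<exists>k\<in>UC_space X. k c \<noteq> (0::'e) \<and> (\<forall>x\<in>X. r \<le> dist x c \<longrightarrow> k x = 0)"
    if "c \<in> X" "0 < r" for c r
    using ex_Lip_space_bump[OF that e] Lip_space_subset_UC_space by blast
  have "\<forall>n. \<exists>k\<in>UC_space X. k (a n) \<noteq> (0::'e) \<and> (\<forall>x\<in>X. \<alpha> n \<le> dist x (a n) \<longrightarrow> k x = 0)"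
    using bump ab by blast
  then obtain u where u: "\<And>n. u n \<in> UC_space X" "\<And>n. u n (a n) \<noteq> (0::'e)"
    "\<And>n x. x \<in> X \<Longrightarrow> \<alpha> n \<le> dist x (a n) \<Longrightarrow> u n x = 0"
    by metis
  have u_ball: "x \<in> ball (a n) (\<alpha> n)" if "x \<in> X" "u n x \<noteq> 0" for x n
    using u(3)[OF that(1), of n] that(2) by (force simp: dist_commute)
  interpret disjoint_sequence X Y T v u
  proof
    show "u n \<in> UC_space X" for n by (rule u)
    show "\<exists>x\<in>X. u n x \<noteq> 0" for n using u(2) ab(1) by blast
    show "u m x = 0 \<or> u n x = 0" if "m \<noteq> n" "x \<in> X" for m n x
      using u_ball aa[OF that(1)] that(2) by blast
  qed
  have pre_ball: "dist x (a n) \<le> \<alpha> n" if x: "x \<in> X" "0 < c" "pre n c x \<noteq> 0" for x n c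
  proof (rule ccontr)
    assume "\<not> ?thesis"
    then have "0 < dist x (a n) - \<alpha> n" by simp
    from bump[OF x(1) this] obtain w :: "'a \<Rightarrow> 'e" where w: "w \<in> UC_space X" "w x \<noteq> 0"
      "\<And>z. z \<in> X \<Longrightarrow> dist x (a n) - \<alpha> n \<le> dist z x \<Longrightarrow> w z = 0"
      by blast
    have "w z = 0 \<or> u n z = 0" if "z \<in> X" for z
      using w(3)[OF that] u(3)[OF that, of n] dist_triangle[of x "a n" z]
      by (cases "\<alpha> n \<le> dist z (a n)") (auto simp: dist_commute)
    then show False using pre_disjoint_from[OF x(2) w(1)] w(2) x by blast
  qed
  have F_zero: "S (range_of_hills c) (b n) = 0" if "0 < c" for c n
  proof -
    obtain w :: "'a \<Rightarrow> 'e" where w: "w \<in> UC_space X" "w (b n) \<noteq> 0" "\<And>z. z \<in> X \<Longrightarrow> \<beta> n \<le> dist z (b n) \<Longrightarrow> w z = 0"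
      using bump[OF ab(2,4)] by blast
    have "w z = 0 \<or> u m z = 0" if "z \<in> X" for z m
    proof (rule ccontr)
      assume *: "\<not> ?thesis"
      then have "z \<in> ball (b n) (\<beta> n)" using w(3)[OF that] by (force simp: dist_commute)
      then show False using u_ball[OF that, of m] abd[of m n] that * by blast
    qed
    then show ?thesis using S_range_of_hills_disjoint_from[OF that w(1)] w(2) ab(2) by blast
  qed
  have radius: "\<alpha> n \<le> dist (a n) (b n)" for n
  proof -
    have "b n \<notin> ball (a n) (\<alpha> n)" using abd[of n n] ab(2)[of n] ab(4)[of n] by auto
    then show ?thesis by simp
  qed
  have small: "\<forall>\<^sub>F n in sequentially. \<forall>x\<in>X. norm (pre n c x) \<le> \<epsilon>" if c: "0 < c" and \<epsilon>: "0 < \<epsilon>" for c \<epsilon>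
  proof -
    let ?F = "S (range_of_hills c)"
    have "uniformly_continuous_on X ?F"
      using S_in[OF range_of_hills_in[OF c]] by (simp add: UC_space_def)
    then obtain \<delta> where \<delta>: "0 < \<delta>"
      "\<And>x x'. x \<in> X \<Longrightarrow> x' \<in> X \<Longrightarrow> dist x' x < \<delta> \<Longrightarrow> dist (?F x') (?F x) < \<epsilon>"
      using \<epsilon> unfolding uniformly_continuous_on_def by metis
    have "\<forall>\<^sub>F n in sequentially. dist (a n) (b n) < \<delta> / 2"
      using lim \<delta>(1) by (intro order_tendstoD) auto
    then show ?thesis
    proof eventually_elim
      case (elim n)
      show ?case
      proof
        fix x assume x: "x \<in> X"
        show "norm (pre n c x) \<le> \<epsilon>"
        proof (cases "pre n c x = 0")
          case False
          have "dist x (b n) \<le> dist x (a n) + dist (a n) (b n)" by (rule dist_triangle)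
          then have "dist x (b n) < \<delta>"
            using pre_ball[OF x c False] radius[of n] elim by linarith
          then have "norm (?F x) < \<epsilon>" using \<delta>(2)[OF ab(2)[of n] x] F_zero[OF c] by simp
          then show ?thesis using pre_restricts_S_range_of_hills[OF c x, of n] False by simp
        qed (use \<epsilon> in simp)
      qed
    qed
  qed
  show False
  proof (rule not_gluable)
    fix C :: "nat \<Rightarrow> real" assume C: "\<And>k. 0 < C k"
    have "\<forall>k. \<exists>N. \<forall>n\<ge>N. \<forall>x\<in>X. norm (pre n (C k) x) \<le> 1 / real (Suc k)"
      using small[OF C] by (simp add: eventually_sequentially)
    then obtain N where N: "\<And>k n x. N k \<le> n \<Longrightarrow> x \<in> X \<Longrightarrow> norm (pre n (C k) x) \<le> 1 / real (Suc k)"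
      by metis
    have "(\<lambda>x\<in>X. glue (\<lambda>k. pre (r k) (C k)) x) \<in> UC_space X"
      if r: "strict_mono r" "\<forall>k. N k \<le> r k" for r
    proof (rule glue_in_UC_space)
      show "pre (r k) (C k) \<in> UC_space X" for k by (rule pre_in[OF C])
      show "pre (r m) (C m) x = 0 \<or> pre (r n) (C n) x = 0" if "x \<in> X" "m \<noteq> n" for m n x
        using pre_disjoint[OF _ C C that(1)] that(2) strict_mono_eq[OF r(1), of m n] by simp
      show "\<forall>\<^sub>F k in sequentially. \<forall>x\<in>X. norm (pre (r k) (C k) x) \<le> \<epsilon>" if "0 < \<epsilon>" for \<epsilon>
      proof -
        have "\<forall>\<^sub>F k in sequentially. 1 / real (Suc k) < \<epsilon>"
          using LIMSEQ_inverse_real_of_nat that order_tendstoD(2)[of _ 0] by (simp add: inverse_eq_divide)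
        then show ?thesis
          by eventually_elim (use N r(2) in \<open>fastforce intro: order_trans less_imp_le\<close>)
      qed
    qed
    then show "\<exists>N. \<forall>r. strict_mono r \<longrightarrow> (\<forall>k. N k \<le> r k) \<longrightarrow>
        (\<lambda>x\<in>X. glue (\<lambda>k. pre (r k) (C k)) x) \<in> UC_space X"
      by blast
  qed
qed

lemma finite_domain:
  assumes e: "(e::'e) \<noteq> 0"
  shows "finite X"
proof (cases "\<exists>\<epsilon>>0. \<forall>x\<in>X. \<forall>y\<in>X. x \<noteq> y \<longrightarrow> \<epsilon> \<le> dist x y")
  case True
  then show ?thesis using finite_uniformly_discrete_domain[OF e] by blast
next
  case False
  then show ?thesis using no_clustering_domain[OF e] by (meson not_le)
qed

end

section \<open>The characterization\<close>

text \<open>Subtracting \<open>T 0\<close> keeps the map biseparating, since separation only involves differences.\<close>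

lemma biseparating_imp_finite_domain:
  fixes T :: "('a::metric_space \<Rightarrow> 'e::real_normed_vector) \<Rightarrow> ('b::metric_space \<Rightarrow> 'f::real_normed_vector)"
  assumes T: "biseparating X (UC_space X) Y (Lip_space Y) T" and Y: "bounded Y"
    and e: "(e::'e) \<noteq> 0" and v: "(v::'f) \<noteq> 0"
  shows "finite X"
proof -
  define base_image where "base_image = T (\<lambda>x\<in>X. 0)"
  define T' where "T' f = (\<lambda>y\<in>Y. T f y - base_image y)" for f
  have bij: "bij_betw T (UC_space X) (Lip_space Y)" using T by (simp add: biseparating_def)
  have base_image: "base_image \<in> Lip_space Y"
    unfolding base_image_def using bij zero_in_UC_space by (rule bij_betw_apply)
  have "bij_betw (\<lambda>g. \<lambda>y\<in>Y. g y - base_image y) (Lip_space Y) (Lip_space Y)"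
  proof (rule bij_betw_byWitness[where f' = "\<lambda>g. \<lambda>y\<in>Y. g y + base_image y"])
    show "\<forall>g\<in>Lip_space Y. (\<lambda>y\<in>Y. (\<lambda>y\<in>Y. g y - base_image y) y + base_image y) = g"
      by (auto simp: Lip_space_def intro!: extensionalityI[where A = Y])
    show "\<forall>g\<in>Lip_space Y. (\<lambda>y\<in>Y. (\<lambda>y\<in>Y. g y + base_image y) y - base_image y) = g"
      by (auto simp: Lip_space_def intro!: extensionalityI[where A = Y])
  qed (use base_image Lip_space_add Lip_space_diff in blast)+
  from bij_betw_trans[OF bij this] have "bij_betw T' (UC_space X) (Lip_space Y)"
    by (simp add: comp_def T'_def[abs_def])
  moreover have "perp_at X h f g \<longleftrightarrow> perp_at Y (T' h) (T' f) (T' g)"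
    if "f \<in> UC_space X" "g \<in> UC_space X" "h \<in> UC_space X" for f g h
  proof -
    have "perp_at X h f g \<longleftrightarrow> perp_at Y (T h) (T f) (T g)"
      using T that by (simp add: biseparating_def)
    also have "\<dots> \<longleftrightarrow> perp_at Y (T' h) (T' f) (T' g)" by (simp add: perp_at_iff T'_def)
    finally show ?thesis .
  qed
  ultimately have "biseparating X (UC_space X) Y (Lip_space Y) T'" by (simp add: biseparating_def)
  moreover have "T' (\<lambda>x\<in>X. 0) = (\<lambda>y\<in>Y. 0)" by (auto simp: T'_def base_image_def)
  ultimately interpret normalized_biseparating X Y T' "v /\<^sub>R norm v"
    using Y v by unfold_locales auto
  show ?thesis by (rule finite_domain[OF e])
qed

theorem theorem9p2:
  fixes X :: "'a::metric_space set" and Y :: "'b::metric_space set"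
    and T :: "('a \<Rightarrow> 'e::banach) \<Rightarrow> ('b \<Rightarrow> 'f::banach)"
  assumes "complete X" and "complete Y" and "bounded Y"
    and "(UNIV :: 'e set) \<noteq> {0}" and "(UNIV :: 'f set) \<noteq> {0}"
    and "T \<in> UC_space X \<rightarrow> Lip_space Y"
  shows "biseparating X (UC_space X) Y (Lip_space Y) T \<longleftrightarrow>
    finite X \<and> finite Y \<and> card X = card Y \<and>
    (\<exists>(\<psi> :: 'b \<Rightarrow> 'a) (\<Phi> :: 'b \<Rightarrow> 'e \<Rightarrow> 'f).
       bij_betw \<psi> Y X \<and> (\<forall>y\<in>Y. bij (\<Phi> y)) \<and>
       (\<forall>f\<in>UC_space X. \<forall>y\<in>Y. T f y = \<Phi> y (f (\<psi> y))))"
proof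
  obtain e :: 'e where e: "e \<noteq> 0" using assms(4) by auto
  obtain v :: 'f where v: "v \<noteq> 0" using assms(5) by auto
  assume T: "biseparating X (UC_space X) Y (Lip_space Y) T"
  have X: "finite X" by (rule biseparating_imp_finite_domain[OF T assms(3) e v])
  obtain \<psi> \<Phi> where rep: "bij_betw \<psi> Y X" "\<forall>y\<in>Y. bij (\<Phi> y)"
    "\<forall>f\<in>UC_space X. \<forall>y\<in>Y. T f y = \<Phi> y (f (\<psi> y))"
    using finite_domain_representation[OF T X e v] by blast
  then have "finite Y" "card X = card Y"
    using X bij_betw_finite[OF rep(1)] bij_betw_same_card[OF rep(1)] by auto
  with X rep show "finite X \<and> finite Y \<and> card X = card Y \<and>
    (\<exists>(\<psi> :: 'b \<Rightarrow> 'a) (\<Phi> :: 'b \<Rightarrow> 'e \<Rightarrow> 'f).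
       bij_betw \<psi> Y X \<and> (\<forall>y\<in>Y. bij (\<Phi> y)) \<and>
       (\<forall>f\<in>UC_space X. \<forall>y\<in>Y. T f y = \<Phi> y (f (\<psi> y))))"
    by blast
next
  assume "finite X \<and> finite Y \<and> card X = card Y \<and>
    (\<exists>(\<psi> :: 'b \<Rightarrow> 'a) (\<Phi> :: 'b \<Rightarrow> 'e \<Rightarrow> 'f).
       bij_betw \<psi> Y X \<and> (\<forall>y\<in>Y. bij (\<Phi> y)) \<and>
       (\<forall>f\<in>UC_space X. \<forall>y\<in>Y. T f y = \<Phi> y (f (\<psi> y))))"
  then obtain \<psi> \<Phi> where "finite X" "finite Y" "bij_betw \<psi> Y X" "\<And>y. y \<in> Y \<Longrightarrow> bij (\<Phi> y)"
    "\<And>f y. f \<in> UC_space X \<Longrightarrow> y \<in> Y \<Longrightarrow> T f y = \<Phi> y (f (\<psi> y))"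
    by blast
  with assms(6) show "biseparating X (UC_space X) Y (Lip_space Y) T"
    by (intro finite_representation_imp_biseparating)
qed

end
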